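(* Let $G$ be a graph and let $\ell$ be a $2$-intersecting supermodular weakly subadditive nonnegative integer-valued function on subsets of $V(G)$. Suppose that $d_G(v)\ge 2\ell(v)$ for each vertex $v$, and that for any two disjoint vertex sets $A$ and $B$ with $A\cup B\subsetneq V(G)$ and $e_G(A\cup B)>\sum_{v\in A\cup B}\ell(v)-\ell(A\cup B)$, $$d_{G-B}(A)\ge 2\ell(A\cup B)-\sum_{v\in B}\ell(v).$$ Then for every edge set $M\subseteq E(G)$ with $|M|\le\ell(V(G))$, $G$ has a spanning $\ell$-rigid subgraph $H$ with $E(H)\cap M=\emptyset$.
   Context: Graphs are finite, loopless, multiple edges allowed. $d_G(X)$ (resp. $d_{G-B}(A)$) is the number of edges of $G$ (resp. $G-B$) with exactly one end in $X$ (resp. $A$); $e_G(X)$ is the number of edges with both ends in $X$. Set functions are zero on $\emptyset$, $\ell(v)=\ell(\{v\})$. $\ell$ is $2$-intersecting supermodular if $\ell(A\cap B)+\ell(A\cup B)\ge\ell(A)+\ell(B)$ whenever $|A\cap B|\ge 2$; weakly subadditive if $\sum_{v\in A}\ell(v)\ge\ell(A)$ for all $A$. A graph $H$ is $\ell$-rigid if it has a spanning subgraph $F$ with $e_F(X)\le\sum_{v\in X}\ell(v)-\ell(X)$ for all $X\subseteq V(H)$ and $|E(F)|=\sum_{v\in V(H)}\ell(v)-\ell(V(H))$. *)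

theory Defs
  imports Main
begin

record ('v, 'e) mgraph =
  mverts :: "'v set"
  medges :: "'e set"
  mends :: "'e \<Rightarrow> 'v set"

text \<open>Each edge has a two-element set of ends, which excludes loops; distinct edges may have
  the same ends. The values of \<open>mends\<close> outside \<open>medges\<close> are irrelevant.\<close>

definition multigraph :: "('v, 'e) mgraph \<Rightarrow> bool" where
  "multigraph G \<longleftrightarrow> finite (mverts G) \<and> finite (medges G) \<and>
     (\<forall>e \<in> medges G. mends G e \<subseteq> mverts G \<and> card (mends G e) = 2)"

definition cut_deg :: "('v, 'e) mgraph \<Rightarrow> 'v set \<Rightarrow> nat" where
  "cut_deg G X = card {e \<in> medges G. card (mends G e \<inter> X) = 1}"

definition inner_edges :: "('v, 'e) mgraph \<Rightarrow> 'v set \<Rightarrow> nat" where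
  "inner_edges G X = card {e \<in> medges G. mends G e \<subseteq> X}"

definition delete_verts :: "('v, 'e) mgraph \<Rightarrow> 'v set \<Rightarrow> ('v, 'e) mgraph" where
  "delete_verts G B =
     \<lparr>mverts = mverts G - B, medges = {e \<in> medges G. mends G e \<inter> B = {}}, mends = mends G\<rparr>"

definition spanning_subgraph :: "('v, 'e) mgraph \<Rightarrow> ('v, 'e) mgraph \<Rightarrow> bool" where
  "spanning_subgraph H G \<longleftrightarrow> mverts H = mverts G \<and> medges H \<subseteq> medges G \<and>
     (\<forall>e \<in> medges H. mends H e = mends G e)"

definition two_intersecting_supermodular :: "'v set \<Rightarrow> ('v set \<Rightarrow> int) \<Rightarrow> bool" where
  "two_intersecting_supermodular V l \<longleftrightarrow>
     (\<forall>A B. A \<subseteq> V \<longrightarrow> B \<subseteq> V \<longrightarrow> card (A \<inter> B) \<ge> 2 \<longrightarrow>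
        l (A \<inter> B) + l (A \<union> B) \<ge> l A + l B)"

definition weakly_subadditive :: "'v set \<Rightarrow> ('v set \<Rightarrow> int) \<Rightarrow> bool" where
  "weakly_subadditive V l \<longleftrightarrow> (\<forall>A. A \<subseteq> V \<longrightarrow> (\<Sum>v\<in>A. l {v}) \<ge> l A)"

definition rigid :: "('v set \<Rightarrow> int) \<Rightarrow> ('v, 'e) mgraph \<Rightarrow> bool" where
  "rigid l H \<longleftrightarrow> (\<exists>F. spanning_subgraph F H \<and>
     (\<forall>X. X \<subseteq> mverts H \<longrightarrow> int (inner_edges F X) \<le> (\<Sum>v\<in>X. l {v}) - l X) \<and>
     int (card (medges F)) = (\<Sum>v\<in>mverts H. l {v}) - l (mverts H))"

end

theory Submission
  imports Defs
begin

text \<open>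
  Write \<open>f X = (\<Sum>v\<in>X. l {v}) - l X\<close> and call an edge set \<open>F\<close> sparse if every \<open>X\<close> induces at
  most \<open>f X\<close> edges of \<open>F\<close>. Choose a maximal sparse \<open>F\<close> avoiding \<open>M\<close>. Every edge outside
  \<open>F \<union> M\<close> lies in a tight set, and by supermodularity two tight sets that share at least two
  vertices have a tight union. If the whole vertex set is not tight, let \<open>T\<close> be the family of
  those maximal tight sets that induce an edge outside \<open>F\<close>; its members meet pairwise in at
  most one vertex. Split each \<open>X \<in> T\<close> into the set \<open>B\<close> of vertices that lie in another
  member and the set \<open>A\<close> of the others. Edges leaving \<open>A\<close> in \<open>G - B\<close>, and edges at
  vertices not covered by \<open>T\<close>, are induced by no member of \<open>T\<close>, so the degree hypotheses bound
  the number of such edges from below; this forces \<open>F\<close> to have at least \<open>f V\<close> edges.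
\<close>

section \<open>Sparse edge sets and tight vertex sets\<close>

definition sparsity :: "('v set \<Rightarrow> int) \<Rightarrow> 'v set \<Rightarrow> int" where
  "sparsity l X = (\<Sum>v\<in>X. l {v}) - l X"

text \<open>\<open>F\<close> is a bare edge set rather than a subgraph: it varies while the fixed
  \<open>G\<close> supplies the ends.\<close>

definition induced :: "('v, 'e) mgraph \<Rightarrow> 'e set \<Rightarrow> 'v set \<Rightarrow> 'e set" where
  "induced G F X = {e \<in> F. mends G e \<subseteq> X}"

definition sparse :: "('v, 'e) mgraph \<Rightarrow> ('v set \<Rightarrow> int) \<Rightarrow> 'e set \<Rightarrow> bool" where
  "sparse G l F \<longleftrightarrow> (\<forall>X \<subseteq> mverts G. int (card (induced G F X)) \<le> sparsity l X)"

definition tight :: "('v, 'e) mgraph \<Rightarrow> ('v set \<Rightarrow> int) \<Rightarrow> 'e set \<Rightarrow> 'v set \<Rightarrow> bool" where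
  "tight G l F X \<longleftrightarrow> X \<subseteq> mverts G \<and> int (card (induced G F X)) = sparsity l X"

definition coverage :: "'v set set \<Rightarrow> 'v \<Rightarrow> nat" where
  "coverage T v = card {X \<in> T. v \<in> X}"

definition uncovered_edges :: "('v, 'e) mgraph \<Rightarrow> 'v set set \<Rightarrow> 'e set" where
  "uncovered_edges G T = {e \<in> medges G. \<forall>X \<in> T. \<not> mends G e \<subseteq> X}"

lemma finite_induced: "finite F \<Longrightarrow> finite (induced G F X)"
  by (simp add: induced_def)

lemma sparsity_submodular:
  assumes "two_intersecting_supermodular V l" "finite V" "X \<subseteq> V" "Y \<subseteq> V" "card (X \<inter> Y) \<ge> 2"
  shows "sparsity l (X \<inter> Y) + sparsity l (X \<union> Y) \<le> sparsity l X + sparsity l Y"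
proof -
  have "l (X \<inter> Y) + l (X \<union> Y) \<ge> l X + l Y"
    using assms unfolding two_intersecting_supermodular_def by blast
  moreover have "finite X" "finite Y"
    using assms finite_subset by blast+
  then have "(\<Sum>v\<in>X \<union> Y. l {v}) + (\<Sum>v\<in>X \<inter> Y. l {v}) = (\<Sum>v\<in>X. l {v}) + (\<Sum>v\<in>Y. l {v})"
    by (rule sum.union_inter)
  ultimately show ?thesis
    by (simp add: sparsity_def)
qed

text \<open>Inclusion-exclusion: an edge inside both sets is inside \<open>X \<inter> Y\<close>, and
  an edge inside either one is inside \<open>X \<union> Y\<close>.\<close>

lemma card_induced_supermodular:
  assumes "finite F"
  shows "card (induced G F X) + card (induced G F Y)
    \<le> card (induced G F (X \<union> Y)) + card (induced G F (X \<inter> Y))"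
proof -
  have "card (induced G F X) + card (induced G F Y)
    = card (induced G F X \<union> induced G F Y) + card (induced G F X \<inter> induced G F Y)"
    using assms finite_induced by (intro card_Un_Int) blast+
  moreover have "card (induced G F X \<union> induced G F Y) \<le> card (induced G F (X \<union> Y))"
    using assms by (intro card_mono finite_induced) (auto simp: induced_def)
  moreover have "induced G F X \<inter> induced G F Y = induced G F (X \<inter> Y)"
    by (auto simp: induced_def)
  ultimately show ?thesis
    by simp
qed

text \<open>Uncrossing: induced counts are supermodular, \<open>sparsity\<close> is submodular on
  this pair, and sparsity of \<open>F\<close> bounds the former by the latter on both the union and
  the intersection. Tightness of \<open>X\<close> and \<open>Y\<close> therefore forces equality
  throughout.\<close>

lemma tight_Un:
  assumes "two_intersecting_supermodular (mverts G) l" "finite (mverts G)" "finite F"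
    and "sparse G l F" "tight G l F X" "tight G l F Y" "card (X \<inter> Y) \<ge> 2"
  shows "tight G l F (X \<union> Y)"
proof -
  have XY: "X \<subseteq> mverts G" "Y \<subseteq> mverts G"
    using assms by (auto simp: tight_def)
  have "int (card (induced G F (X \<inter> Y))) \<le> sparsity l (X \<inter> Y)"
    "int (card (induced G F (X \<union> Y))) \<le> sparsity l (X \<union> Y)"
    using assms(4) XY unfolding sparse_def by (meson Un_least le_infI1)+
  moreover have "int (card (induced G F X)) = sparsity l X" "int (card (induced G F Y)) = sparsity l Y"
    using assms by (auto simp: tight_def)
  ultimately have "int (card (induced G F (X \<union> Y))) = sparsity l (X \<union> Y)"
    using sparsity_submodular[OF assms(1,2) XY assms(7)] card_induced_supermodular[OF assms(3), of G X Y]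
    by linarith
  then show ?thesis
    using XY by (simp add: tight_def)
qed

section \<open>Maximal sparse edge sets and maximal tight vertex sets\<close>

lemma maximal_sparse_exists:
  assumes "finite E" "sparse G l {}"
  obtains F where "F \<subseteq> E" "sparse G l F"
    "\<And>e. e \<in> E \<Longrightarrow> e \<notin> F \<Longrightarrow> \<not> sparse G l (insert e F)"
proof -
  let ?S = "{F. F \<subseteq> E \<and> sparse G l F}"
  have "finite ?S" "?S \<noteq> {}"
    using assms by auto
  then obtain F where F: "F \<in> ?S" "\<And>F'. F' \<in> ?S \<Longrightarrow> F \<subseteq> F' \<Longrightarrow> F = F'"
    using finite_has_maximal[of ?S] by auto
  show ?thesis
  proof (rule that[of F])
    fix e assume "e \<in> E" "e \<notin> F"
    then show "\<not> sparse G l (insert e F)"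
      using F(1) F(2)[of "insert e F"] by blast
  qed (use F(1) in auto)
qed

text \<open>A set violated by \<open>insert e F\<close> but not by \<open>F\<close> must contain the
  ends of \<open>e\<close>; it is then tight and can be enlarged to a maximal tight set.\<close>

lemma maximal_tight_exists:
  assumes "finite (mverts G)" "finite F" "sparse G l F" "\<not> sparse G l (insert e F)"
  obtains X where "tight G l F X" "mends G e \<subseteq> X"
    "\<And>Y. tight G l F Y \<Longrightarrow> X \<subseteq> Y \<Longrightarrow> X = Y"
proof -
  obtain X where X: "X \<subseteq> mverts G" "int (card (induced G (insert e F) X)) > sparsity l X"
    using assms(4) by (auto simp: sparse_def not_le)
  have le: "int (card (induced G F X)) \<le> sparsity l X"
    using X assms(3) by (auto simp: sparse_def)
  have eX: "mends G e \<subseteq> X"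
  proof (rule ccontr)
    assume "\<not> mends G e \<subseteq> X"
    then have "induced G (insert e F) X = induced G F X"
      by (auto simp: induced_def)
    then show False
      using X le by simp
  qed
  then have "induced G (insert e F) X = insert e (induced G F X)"
    by (auto simp: induced_def)
  \<comment> \<open>The count grows by at most one yet passes the integer bound, so it met the bound
    exactly before.\<close>
  then have "card (induced G (insert e F) X) \<le> card (induced G F X) + 1"
    by (simp add: card_insert_if finite_induced[OF assms(2)])
  then have X_tight: "tight G l F X"
    using X le by (simp add: tight_def)
  let ?S = "{Y. tight G l F Y \<and> X \<subseteq> Y}"
  have "?S \<subseteq> Pow (mverts G)"
    by (auto simp: tight_def)
  then have "finite ?S"
    using assms(1) finite_subset by blast
  moreover have "?S \<noteq> {}"
    using X_tight by auto
  ultimately obtain Y where Y: "Y \<in> ?S" "\<And>Z. Z \<in> ?S \<Longrightarrow> Y \<subseteq> Z \<Longrightarrow> Y = Z"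
    using finite_has_maximal[of ?S] by auto
  show ?thesis
  proof (rule that[of Y])
    show "Y = Z" if "tight G l F Z" "Y \<subseteq> Z" for Z
      using Y that by auto
  qed (use Y eX in auto)
qed

section \<open>Double counting over a family of vertex sets\<close>

lemma sum_coverage:
  fixes g :: "'v \<Rightarrow> int"
  assumes "finite V" "finite T" "\<And>X. X \<in> T \<Longrightarrow> X \<subseteq> V"
  shows "(\<Sum>X\<in>T. \<Sum>v\<in>{v \<in> X. P v}. g v) = (\<Sum>v\<in>V. if P v then int (coverage T v) * g v else 0)"
proof -
  have "(\<Sum>X\<in>T. \<Sum>v\<in>{v \<in> X. P v}. g v) = (\<Sum>X\<in>T. \<Sum>v\<in>{v \<in> V. v \<in> X \<and> P v}. g v)"
    using assms(3) by (intro sum.cong) auto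
  also have "\<dots> = (\<Sum>v\<in>V. \<Sum>X\<in>{X \<in> T. v \<in> X \<and> P v}. g v)"
    by (rule sum.swap_restrict[OF assms(2,1)])
  also have "\<dots> = (\<Sum>v\<in>V. if P v then int (coverage T v) * g v else 0)"
    by (intro sum.cong) (auto simp: coverage_def)
  finally show ?thesis .
qed

lemma coverage_pos:
  assumes "finite T" "X \<in> T" "v \<in> X"
  shows "coverage T v > 0"
proof -
  have "finite {X \<in> T. v \<in> X}" "{X \<in> T. v \<in> X} \<noteq> {}"
    using assms by auto
  then show ?thesis
    unfolding coverage_def card_gt_0_iff by blast
qed

lemma coverage_eq_1_unique:
  assumes "coverage T v = 1" "X \<in> T" "v \<in> X" "Y \<in> T" "v \<in> Y"
  shows "X = Y"
proof -
  obtain Z where "{X \<in> T. v \<in> X} = {Z}"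
    using assms(1) unfolding coverage_def by (rule card_1_singletonE)
  then have "X \<in> {Z}" "Y \<in> {Z}"
    using assms(2-5) by (auto simp: set_eq_iff)
  then show ?thesis
    by simp
qed

text \<open>Every edge counted on the left is uncovered. The uncovered vertices and the sets of
  vertices covered exactly once are pairwise disjoint, so each edge has at most two ends to
  contribute.\<close>

lemma degree_sum_le_uncovered_edges:
  assumes G: "multigraph G" and T: "finite T" "\<And>X. X \<in> T \<Longrightarrow> X \<subseteq> mverts G"
  shows "(\<Sum>v\<in>{v \<in> mverts G. coverage T v = 0}. cut_deg G {v})
      + (\<Sum>X\<in>T. cut_deg (delete_verts G {v \<in> X. coverage T v \<ge> 2}) {v \<in> X. coverage T v = 1})
    \<le> 2 * card (uncovered_edges G T)"
proof -
  define U where "U = {v \<in> mverts G. coverage T v = 0}"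
  define A where "A X = {v \<in> X. coverage T v = 1}" for X
  define B where "B X = {v \<in> X. coverage T v \<ge> 2}" for X
  define E where "E = uncovered_edges G T"
  have finV: "finite (mverts G)" and finE: "finite (medges G)"
    and ends: "\<And>e. e \<in> medges G \<Longrightarrow> mends G e \<subseteq> mverts G \<and> card (mends G e) = 2"
    using G by (auto simp: multigraph_def)
  have fE: "finite E" and EG: "E \<subseteq> medges G"
    using finE by (auto simp: E_def uncovered_edges_def)
  have fends: "finite (mends G e)" if "e \<in> medges G" for e
    using ends[OF that] finV finite_subset by blast
  have fU: "finite U"
    using finV by (simp add: U_def)
  have split: "X = A X \<union> B X" if "X \<in> T" for X
    using coverage_pos[OF T(1) that] by (force simp: A_def B_def)
  \<comment> \<open>Cut degrees become sums of end counts over the common set \<open>E\<close>: a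
    cut edge contributes exactly 1, and any other edge of \<open>E\<close> only adds to the
    right-hand side.\<close>
  have indicator: "card S \<le> (\<Sum>e\<in>E. card (mends G e \<inter> W))"
    if "S \<subseteq> E" "\<And>e. e \<in> S \<Longrightarrow> card (mends G e \<inter> W) = 1" for S W
  proof -
    have "card S = (\<Sum>e\<in>S. card (mends G e \<inter> W))"
      using that(2) by simp
    also have "\<dots> \<le> (\<Sum>e\<in>E. card (mends G e \<inter> W))"
      using that(1) fE by (intro sum_mono2) auto
    finally show ?thesis .
  qed
  have U_le: "cut_deg G {v} \<le> (\<Sum>e\<in>E. card (mends G e \<inter> {v}))" if "v \<in> U" for v
    unfolding cut_deg_def
  proof (rule indicator)
    show "{e \<in> medges G. card (mends G e \<inter> {v}) = 1} \<subseteq> E"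
    proof clarsimp
      fix e assume e: "e \<in> medges G" "card (mends G e \<inter> {v}) = Suc 0"
      then have "v \<in> mends G e"
        by (cases "v \<in> mends G e") auto
      moreover have "v \<notin> X" if "X \<in> T" for X
        using coverage_pos[OF T(1) that, of v] \<open>v \<in> U\<close> by (auto simp: U_def)
      ultimately show "e \<in> E"
        using e by (auto simp: E_def uncovered_edges_def)
    qed
  qed auto
  have A_le: "cut_deg (delete_verts G (B X)) (A X) \<le> (\<Sum>e\<in>E. card (mends G e \<inter> A X))"
    if X: "X \<in> T" for X
    unfolding cut_deg_def
  proof (rule indicator)
    show "{e \<in> medges (delete_verts G (B X)).
        card (mends (delete_verts G (B X)) e \<inter> A X) = 1} \<subseteq> E"
    proof
      fix e assume "e \<in> {e \<in> medges (delete_verts G (B X)).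
        card (mends (delete_verts G (B X)) e \<inter> A X) = 1}"
      then have e: "e \<in> medges G" "mends G e \<inter> B X = {}" "card (mends G e \<inter> A X) = 1"
        by (auto simp: delete_verts_def)
      obtain v where v: "mends G e \<inter> A X = {v}"
        using e(3) by (auto simp: card_1_singleton_iff)
      have "\<not> mends G e \<subseteq> Y" if Y: "Y \<in> T" for Y
      proof
        \<comment> \<open>The end \<open>v\<close> lies in one member only, so \<open>Y\<close> is
          \<open>X\<close>. Since \<open>e\<close> avoids \<open>B X\<close>, both its ends then
          fall in \<open>A X\<close>, against its having just one end there.\<close>
        assume sub: "mends G e \<subseteq> Y"
        have "v \<in> Y" "v \<in> X" "coverage T v = 1"
          using v sub by (auto simp: A_def)
        then have "X = Y"
          using coverage_eq_1_unique X Y by metis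
        then have "mends G e \<subseteq> A X"
          using sub split[OF X] e(2) by blast
        then have "card (mends G e \<inter> A X) = 2"
          using ends[OF e(1)] by (simp add: Int_absorb2)
        then show False
          using e(3) by simp
      qed
      then show "e \<in> E"
        using e by (auto simp: E_def uncovered_edges_def)
    qed
  qed (auto simp: delete_verts_def)
  have edge: "(\<Sum>v\<in>U. card (mends G e \<inter> {v})) + (\<Sum>X\<in>T. card (mends G e \<inter> A X)) \<le> 2"
    if "e \<in> E" for e
  proof -
    have fe: "finite (mends G e)" and ce: "card (mends G e) = 2"
      using that EG ends fends by auto
    have "(\<Sum>v\<in>U. card (mends G e \<inter> {v})) = card (\<Union>v\<in>U. mends G e \<inter> {v})"
      using fU fe by (subst card_UN_disjoint) auto
    moreover have "(\<Sum>X\<in>T. card (mends G e \<inter> A X)) = card (\<Union>X\<in>T. mends G e \<inter> A X)"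
    proof (subst card_UN_disjoint)
      show "\<forall>X\<in>T. \<forall>Y\<in>T. X \<noteq> Y \<longrightarrow> (mends G e \<inter> A X) \<inter> (mends G e \<inter> A Y) = {}"
        using coverage_eq_1_unique[of T] by (auto simp: A_def)
    qed (use T fe in auto)
    moreover have "card (\<Union>v\<in>U. mends G e \<inter> {v}) + card (\<Union>X\<in>T. mends G e \<inter> A X)
      = card ((\<Union>v\<in>U. mends G e \<inter> {v}) \<union> (\<Union>X\<in>T. mends G e \<inter> A X))"
      using fU fe T(1) by (subst card_Un_disjoint) (auto simp: U_def A_def)
    moreover have "\<dots> \<le> card (mends G e)"
      using fe by (intro card_mono) auto
    ultimately show ?thesis
      using ce by simp
  qed
  have "(\<Sum>v\<in>U. cut_deg G {v}) + (\<Sum>X\<in>T. cut_deg (delete_verts G (B X)) (A X))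
    \<le> (\<Sum>v\<in>U. \<Sum>e\<in>E. card (mends G e \<inter> {v})) + (\<Sum>X\<in>T. \<Sum>e\<in>E. card (mends G e \<inter> A X))"
    using U_le A_le by (intro add_mono sum_mono) auto
  also have "\<dots> = (\<Sum>e\<in>E. (\<Sum>v\<in>U. card (mends G e \<inter> {v})) + (\<Sum>X\<in>T. card (mends G e \<inter> A X)))"
    unfolding sum.distrib by (rule arg_cong2[where f = "(+)"]; rule sum.swap)
  also have "\<dots> \<le> (\<Sum>e\<in>E. 2)"
    using edge by (intro sum_mono) auto
  finally show ?thesis
    by (simp add: U_def A_def B_def E_def)
qed

text \<open>Insert the degree bounds into the previous estimate and replace \<open>l X\<close> by
  the vertex sum minus \<open>sparsity l X\<close>. A vertex then has coefficient 2 if its coverage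
  \<open>c\<close> is 0 or 1, and \<open>2 * c - c = c\<close> if \<open>c\<close> is at least 2; so
  every coefficient is at least 2, and halving gives the claim.\<close>

lemma uncovered_edges_lower_bound:
  fixes l :: "'v set \<Rightarrow> int"
  assumes G: "multigraph G" and T: "\<And>X. X \<in> T \<Longrightarrow> X \<subset> mverts G"
    and nonneg: "\<And>v. v \<in> mverts G \<Longrightarrow> l {v} \<ge> 0"
    and deg: "\<And>v. v \<in> mverts G \<Longrightarrow> int (cut_deg G {v}) \<ge> 2 * l {v}"
    and cut: "\<And>X A B. X \<in> T \<Longrightarrow> A \<inter> B = {} \<Longrightarrow> A \<union> B = X \<Longrightarrow>
      int (cut_deg (delete_verts G B) A) \<ge> 2 * l X - (\<Sum>v\<in>B. l {v})"
  shows "(\<Sum>v\<in>mverts G. l {v}) \<le> int (card (uncovered_edges G T)) + (\<Sum>X\<in>T. sparsity l X)"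
proof -
  let ?V = "mverts G"
  define c where "c = coverage T"
  have fV: "finite ?V"
    using G by (simp add: multigraph_def)
  have "T \<subseteq> Pow ?V"
    using T by auto
  then have fT: "finite T"
    using fV finite_subset by blast
  have TV: "\<And>X. X \<in> T \<Longrightarrow> X \<subseteq> ?V"
    using T by auto
  have U: "(\<Sum>v\<in>{v \<in> ?V. c v = 0}. int (cut_deg G {v})) \<ge> (\<Sum>v\<in>{v \<in> ?V. c v = 0}. 2 * l {v})"
    using deg by (intro sum_mono) auto
  have A: "(\<Sum>X\<in>T. int (cut_deg (delete_verts G {v \<in> X. c v \<ge> 2}) {v \<in> X. c v = 1}))
    \<ge> (\<Sum>X\<in>T. 2 * l X - (\<Sum>v\<in>{v \<in> X. c v \<ge> 2}. l {v}))"
  proof (rule sum_mono)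
    fix X assume X: "X \<in> T"
    have "{v \<in> X. c v = 1} \<union> {v \<in> X. c v \<ge> 2} = X"
      using coverage_pos[OF fT X] by (force simp: c_def)
    then show "int (cut_deg (delete_verts G {v \<in> X. c v \<ge> 2}) {v \<in> X. c v = 1})
      \<ge> 2 * l X - (\<Sum>v\<in>{v \<in> X. c v \<ge> 2}. l {v})"
      by (intro cut[OF X]) auto
  qed
  have "(\<Sum>X\<in>T. \<Sum>v\<in>{v \<in> X. c v \<ge> 2}. l {v}) = (\<Sum>v\<in>?V. if c v \<ge> 2 then int (c v) * l {v} else 0)"
    unfolding c_def by (rule sum_coverage[OF fV fT TV])
  moreover have covsum: "(\<Sum>X\<in>T. \<Sum>v\<in>X. l {v}) = (\<Sum>v\<in>?V. int (c v) * l {v})"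
    using sum_coverage[OF fV fT TV, where P = "\<lambda>_. True"] by (simp add: c_def)
  moreover have "(\<Sum>v\<in>{v \<in> ?V. c v = 0}. 2 * l {v}) = (\<Sum>v\<in>?V. if c v = 0 then 2 * l {v} else 0)"
    using fV by (simp add: sum.inter_filter)
  \<comment> \<open>The coefficient comparison, vertex by vertex; nonnegativity of
    \<open>l {v}\<close> matters when the coverage is at least 2.\<close>
  moreover have "(\<Sum>v\<in>?V. 2 * l {v}) + (\<Sum>v\<in>?V. if c v \<ge> 2 then int (c v) * l {v} else 0)
    \<le> (\<Sum>v\<in>?V. if c v = 0 then 2 * l {v} else 0) + (\<Sum>v\<in>?V. 2 * (int (c v) * l {v}))"
    unfolding sum.distrib[symmetric]
  proof (rule sum_mono)
    fix v assume v: "v \<in> ?V"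
    consider "c v = 0" | "c v = 1" | "c v \<ge> 2"
      by linarith
    then show "2 * l {v} + (if c v \<ge> 2 then int (c v) * l {v} else 0)
      \<le> (if c v = 0 then 2 * l {v} else 0) + 2 * (int (c v) * l {v})"
    proof cases
      case 3
      then have "2 * l {v} \<le> int (c v) * l {v}"
        using nonneg[OF v] by (intro mult_right_mono) auto
      then show ?thesis
        using 3 by simp
    qed auto
  qed
  moreover have "(\<Sum>v\<in>{v \<in> ?V. c v = 0}. int (cut_deg G {v}))
      + (\<Sum>X\<in>T. int (cut_deg (delete_verts G {v \<in> X. c v \<ge> 2}) {v \<in> X. c v = 1}))
    \<le> 2 * int (card (uncovered_edges G T))"
    using degree_sum_le_uncovered_edges[OF G fT TV]
    unfolding c_def of_nat_sum[symmetric] of_nat_add[symmetric] by linarith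
  ultimately show ?thesis
    using U A by (simp add: sparsity_def sum_subtractf sum_distrib_left[symmetric])
qed

section \<open>Existence of a rigid spanning subgraph avoiding \<open>M\<close>\<close>

theorem theorem3p3:
  fixes G :: "('v, 'e) mgraph" and l :: "'v set \<Rightarrow> int"
  assumes "multigraph G"
    and "l {} = 0"
    and "\<And>A. A \<subseteq> mverts G \<Longrightarrow> l A \<ge> 0"
    and "two_intersecting_supermodular (mverts G) l"
    and "weakly_subadditive (mverts G) l"
    and "\<And>v. v \<in> mverts G \<Longrightarrow> int (cut_deg G {v}) \<ge> 2 * l {v}"
    and "\<And>A B. A \<inter> B = {} \<Longrightarrow> A \<union> B \<subset> mverts G \<Longrightarrow>
           int (inner_edges G (A \<union> B)) > (\<Sum>v\<in>A \<union> B. l {v}) - l (A \<union> B) \<Longrightarrow>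
           int (cut_deg (delete_verts G B) A) \<ge> 2 * l (A \<union> B) - (\<Sum>v\<in>B. l {v})"
  shows "\<forall>M. M \<subseteq> medges G \<longrightarrow> int (card M) \<le> l (mverts G) \<longrightarrow>
           (\<exists>H. spanning_subgraph H G \<and> rigid l H \<and> medges H \<inter> M = {})"
proof (intro allI impI)
  fix M assume M: "M \<subseteq> medges G" "int (card M) \<le> l (mverts G)"
  let ?V = "mverts G"
  have fV: "finite ?V" and fE: "finite (medges G)"
    and ends: "\<And>e. e \<in> medges G \<Longrightarrow> mends G e \<subseteq> ?V \<and> card (mends G e) = 2"
    using assms(1) by (auto simp: multigraph_def)
  have "sparse G l {}"
    using assms(5) by (auto simp: sparse_def weakly_subadditive_def sparsity_def induced_def)
  then obtain F where F: "F \<subseteq> medges G - M" "sparse G l F"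
    and F_max: "\<And>e. e \<in> medges G - M \<Longrightarrow> e \<notin> F \<Longrightarrow> \<not> sparse G l (insert e F)"
    using maximal_sparse_exists[of "medges G - M"] fE by blast
  have fF: "finite F"
    using F fE finite_subset by blast
  have FV: "induced G F ?V = F"
    using F ends by (auto simp: induced_def)
  have V_tight: "tight G l F ?V"
  proof (rule ccontr)
    assume not_tight: "\<not> tight G l F ?V"
    \<comment> \<open>The last condition is the premise of the cut hypothesis; the other premise,
      that members are proper subsets, holds because \<open>?V\<close> is not tight.\<close>
    define T where "T = {X. tight G l F X \<and> (\<forall>Y. tight G l F Y \<longrightarrow> X \<subseteq> Y \<longrightarrow> X = Y)
      \<and> int (inner_edges G X) > sparsity l X}"
    have T: "X \<subset> ?V" if "X \<in> T" for X
      using that not_tight by (auto simp: T_def tight_def)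
    have "T \<subseteq> Pow ?V"
      using T by auto
    then have fT: "finite T"
      using fV finite_subset by blast
    have "(\<Sum>v\<in>?V. l {v}) \<le> int (card (uncovered_edges G T)) + (\<Sum>X\<in>T. sparsity l X)"
    proof (rule uncovered_edges_lower_bound[OF assms(1) T _ assms(6)])
      fix X A B assume "X \<in> T" "A \<inter> B = {}" "A \<union> B = X"
      then show "2 * l X - (\<Sum>v\<in>B. l {v}) \<le> int (cut_deg (delete_verts G B) A)"
        using assms(7)[of A B] T[of X] by (auto simp: T_def sparsity_def)
    qed (use assms(3) in auto)
    \<comment> \<open>Members are tight, and no edge of \<open>F\<close> lies in two of them: its
      two ends would make their union tight, against maximality.\<close>
    moreover have "(\<Sum>X\<in>T. sparsity l X) = int (card (\<Union>X\<in>T. induced G F X))"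
    proof -
      have "induced G F X \<inter> induced G F Y = {}" if XY: "X \<in> T" "Y \<in> T" "X \<noteq> Y" for X Y
      proof (rule ccontr)
        assume "induced G F X \<inter> induced G F Y \<noteq> {}"
        then obtain e where e: "e \<in> F" "mends G e \<subseteq> X \<inter> Y"
          by (auto simp: induced_def)
        moreover have "finite (X \<inter> Y)"
          using T[OF XY(1)] fV finite_subset by blast
        ultimately have "card (X \<inter> Y) \<ge> 2"
          using card_mono[of "X \<inter> Y" "mends G e"] ends[of e] F(1) by auto
        then have "tight G l F (X \<union> Y)"
          using tight_Un[OF assms(4) fV fF F(2)] XY by (auto simp: T_def)
        then have "X = X \<union> Y" "Y = X \<union> Y"
          using XY unfolding T_def by blast+
        then show False
          using XY(3) by simp
      qed
      then have "card (\<Union>X\<in>T. induced G F X) = (\<Sum>X\<in>T. card (induced G F X))"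
        using fT finite_induced[OF fF] by (intro card_UN_disjoint) blast+
      then show ?thesis
        by (simp add: T_def tight_def)
    qed
    moreover have "uncovered_edges G T - M \<subseteq> F - (\<Union>X\<in>T. induced G F X)"
    proof
      fix e assume e: "e \<in> uncovered_edges G T - M"
      have "e \<in> F"
      proof (rule ccontr)
        assume nF: "e \<notin> F"
        have eE: "e \<in> medges G - M"
          using e by (auto simp: uncovered_edges_def)
        obtain X where X: "tight G l F X" "mends G e \<subseteq> X"
          "\<And>Y. tight G l F Y \<Longrightarrow> X \<subseteq> Y \<Longrightarrow> X = Y"
          using maximal_tight_exists[OF fV fF F(2) F_max[OF eE nF]] by blast
        \<comment> \<open>The edge \<open>e\<close> itself witnesses strictness, which puts
          \<open>X\<close> into \<open>T\<close>.\<close>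
        have "induced G F X \<subset> {e \<in> medges G. mends G e \<subseteq> X}"
          using F(1) eE nF X(2) by (auto simp: induced_def)
        then have "card (induced G F X) < inner_edges G X"
          unfolding inner_edges_def using fE by (intro psubset_card_mono) auto
        then have "X \<in> T"
          using X by (auto simp: T_def tight_def)
        then show False
          using e X(2) by (auto simp: uncovered_edges_def)
      qed
      then show "e \<in> F - (\<Union>X\<in>T. induced G F X)"
        using e by (auto simp: uncovered_edges_def induced_def)
    qed
    then have "card (uncovered_edges G T - M) \<le> card (F - (\<Union>X\<in>T. induced G F X))"
      using fF by (intro card_mono) auto
    moreover have "card (uncovered_edges G T) \<le> card (uncovered_edges G T - M) + card M"
      using diff_card_le_card_Diff[OF finite_subset[OF M(1) fE], of "uncovered_edges G T"] by linarith
    moreover have "card F = card (F - (\<Union>X\<in>T. induced G F X)) + card (\<Union>X\<in>T. induced G F X)"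
    proof -
      have "(\<Union>X\<in>T. induced G F X) \<subseteq> F"
        by (auto simp: induced_def)
      then show ?thesis
        using fF card_mono[OF fF] by (simp add: card_Diff_subset finite_subset[OF _ fF])
    qed
    moreover have "int (card F) < sparsity l ?V"
      using not_tight F(2) FV by (force simp: tight_def sparse_def)
    \<comment> \<open>With \<open>s\<close> the sum of all \<open>l {v}\<close>, the bounds give
      \<open>s \<le> card M + card F\<close>, whereas \<open>card M \<le> l ?V\<close> and
      \<open>card F < s - l ?V\<close>.\<close>
    ultimately show False
      using M(2) by (simp add: sparsity_def)
  qed
  \<comment> \<open>The subgraph with edge set \<open>F\<close> serves both as \<open>H\<close> and
    as its own witness of rigidity.\<close>
  let ?H = "G\<lparr>medges := F\<rparr>"
  have "int (inner_edges ?H X) \<le> (\<Sum>v\<in>X. l {v}) - l X" if "X \<subseteq> ?V" for X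
    using F(2) that by (simp add: inner_edges_def sparse_def induced_def sparsity_def)
  moreover have "int (card F) = (\<Sum>v\<in>?V. l {v}) - l ?V"
    using V_tight FV by (simp add: tight_def sparsity_def)
  ultimately have "rigid l ?H"
    unfolding rigid_def by (intro exI[of _ ?H]) (auto simp: spanning_subgraph_def)
  then show "\<exists>H. spanning_subgraph H G \<and> rigid l H \<and> medges H \<inter> M = {}"
    using F(1) by (intro exI[of _ ?H]) (auto simp: spanning_subgraph_def)
qed

end
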